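(* Let $\mathbf{X}$ and $\mathbf{Y}$ be topological spaces with carriers $X$ and $Y$, let $\mathcal U=\{U_i\}_{i\in I}$ be an indexed base of $\mathbf X$ and $\mathcal V=\{V_j\}_{j\in J}$ an indexed base of $\mathbf Y$, where $I,J\subseteq\mathbb N$, and let $f:E\to Y$ with $E\subseteq X$. If there exists a recursively enumerable $(\mathcal U,\mathcal V)$-approximation system for $f$, then $f$ is $(\mathcal U,\mathcal V)$-computable.
   Context: A $(\mathcal U,\mathcal V)$-approximation system for $f$ is a subset $R\subseteq I\times J$ such that for every $x\in E$ and every $j\in J$: $f(x)\in V_j$ if and only if there exists $i$ with $(i,j)\in R$ and $x\in U_i$. For $x\in X$ let $[x]_{\mathcal U}=\{i\in I\mid x\in U_i\}$ and for $y\in Y$ let $[y]_{\mathcal V}=\{j\in J\mid y\in V_j\}$. The function $f$ is $(\mathcal U,\mathcal V)$-computable if there exists an enumeration operator $F:\mathcal P(\mathbb N)\to\mathcal P(\mathbb N)$ such that $[f(x)]_{\mathcal V}=F([x]_{\mathcal U})$ for every $x\in E$. (An enumeration operator is a map of the form $F(M)=\{j\mid \exists\text{ finite }D\subseteq M,\ (D,j)\in W\}$ for some recursively enumerable set $W$ of pairs (canonical index of finite set, number).) *)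

theory Defs
  imports "HOL-Analysis.Analysis" "HOL-Library.Nat_Bijection"
begin

text \<open>
  Kleene's schemes for the partial recursive functions. The predicate \<open>recf_arity n c\<close> says that
  \<open>c\<close> denotes an \<open>n\<close>-ary partial function; \<open>recf_eval c xs\<close> is meaningful only for
  \<open>length xs = n\<close>, and \<^const>\<open>None\<close> means divergence. Composition is strict, primitive recursion
  is on the first argument, and minimisation searches over a new first argument.
\<close>

datatype recf =
    Zero
  | Succ
  | Proj nat
  | Comp recf "recf list"
  | Prec recf recf
  | Mu recf

fun recf_arity :: "nat \<Rightarrow> recf \<Rightarrow> bool" where
  "recf_arity n Zero \<longleftrightarrow> True"
| "recf_arity n Succ \<longleftrightarrow> n = 1"
| "recf_arity n (Proj i) \<longleftrightarrow> i < n"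
| "recf_arity n (Comp f gs) \<longleftrightarrow> recf_arity (length gs) f \<and> (\<forall>g\<in>set gs. recf_arity n g)"
| "recf_arity n (Prec f g) \<longleftrightarrow> n \<ge> 1 \<and> recf_arity (n - 1) f \<and> recf_arity (n + 1) g"
| "recf_arity n (Mu f) \<longleftrightarrow> recf_arity (n + 1) f"

text \<open>The condition on \<open>m < n\<close> in the last equation makes minimisation diverge when the search
  meets an undefined value before the first zero.\<close>

fun recf_eval :: "recf \<Rightarrow> nat list \<Rightarrow> nat option" where
  "recf_eval Zero xs = Some 0"
| "recf_eval Succ xs = Some (Suc (hd xs))"
| "recf_eval (Proj i) xs = Some (xs ! i)"
| "recf_eval (Comp f gs) xs =
     Option.bind (those (map (\<lambda>g. recf_eval g xs) gs)) (\<lambda>ys. recf_eval f ys)"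
| "recf_eval (Prec f g) xs =
     rec_nat (recf_eval f (tl xs))
       (\<lambda>n r. Option.bind r (\<lambda>y. recf_eval g (n # y # tl xs))) (hd xs)"
| "recf_eval (Mu f) xs =
     (if \<exists>n. recf_eval f (n # xs) = Some 0 \<and> (\<forall>m<n. recf_eval f (m # xs) \<noteq> None)
      then Some (LEAST n. recf_eval f (n # xs) = Some 0 \<and> (\<forall>m<n. recf_eval f (m # xs) \<noteq> None))
      else None)"

text \<open>A set of pairs is recursively enumerable if it is the domain of a binary partial recursive
  function.\<close>

definition re_pairs :: "(nat \<times> nat) set \<Rightarrow> bool" where
  "re_pairs A \<longleftrightarrow> (\<exists>c. recf_arity 2 c \<and> A = {(a, b). recf_eval c [a, b] \<noteq> None})"

text \<open>The canonical index of a finite set \<open>D\<close> is \<^term>\<open>set_encode D = (\<Sum>x\<in>D. 2 ^ x)\<close>.\<close>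

definition enumeration_operator :: "(nat set \<Rightarrow> nat set) \<Rightarrow> bool" where
  "enumeration_operator F \<longleftrightarrow>
     (\<exists>W. re_pairs W \<and>
        (\<forall>M. F M = {j. \<exists>D. finite D \<and> D \<subseteq> M \<and> (set_encode D, j) \<in> W}))"

definition indexed_base :: "'a topology \<Rightarrow> nat set \<Rightarrow> (nat \<Rightarrow> 'a set) \<Rightarrow> bool" where
  "indexed_base X I U \<longleftrightarrow>
     (\<forall>i\<in>I. openin X (U i)) \<and>
     (\<forall>S. openin X S \<longrightarrow> (\<exists>K\<subseteq>I. S = (\<Union>i\<in>K. U i)))"

text \<open>\<open>nbhd_indices I U x\<close> is the set \<open>[x]\<close> with respect to the family \<open>U\<close> indexed by \<open>I\<close>.\<close>

definition nbhd_indices :: "nat set \<Rightarrow> (nat \<Rightarrow> 'a set) \<Rightarrow> 'a \<Rightarrow> nat set" where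
  "nbhd_indices I U x = {i \<in> I. x \<in> U i}"

definition approximation_system ::
  "nat set \<Rightarrow> (nat \<Rightarrow> 'a set) \<Rightarrow> nat set \<Rightarrow> (nat \<Rightarrow> 'b set) \<Rightarrow> 'a set \<Rightarrow> ('a \<Rightarrow> 'b) \<Rightarrow>
   (nat \<times> nat) set \<Rightarrow> bool" where
  "approximation_system I U J V E f R \<longleftrightarrow>
     R \<subseteq> I \<times> J \<and>
     (\<forall>x\<in>E. \<forall>j\<in>J. f x \<in> V j \<longleftrightarrow> (\<exists>i. (i, j) \<in> R \<and> x \<in> U i))"

definition computable_wrt ::
  "nat set \<Rightarrow> (nat \<Rightarrow> 'a set) \<Rightarrow> nat set \<Rightarrow> (nat \<Rightarrow> 'b set) \<Rightarrow> 'a set \<Rightarrow> ('a \<Rightarrow> 'b) \<Rightarrow> bool" where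
  "computable_wrt I U J V E f \<longleftrightarrow>
     (\<exists>F. enumeration_operator F \<and>
        (\<forall>x\<in>E. nbhd_indices J V (f x) = F (nbhd_indices I U x)))"

end

theory Submission
  imports Defs
begin

text \<open>
  Replacing each pair \<open>(i, j)\<close> of an approximation system \<open>R\<close> by \<open>({i}, j)\<close> gives a set of axioms
  whose enumeration operator sends \<open>M\<close> to \<open>{j. \<exists>i\<in>M. (i, j) \<in> R}\<close>, and for \<open>M = [x]\<close> this is
  \<open>[f x]\<close>. The canonical index of \<open>{i}\<close> is \<open>2 ^ i\<close>, so the axioms stay recursively enumerable:
  given \<open>d\<close>, search for \<open>i\<close> with \<open>2 ^ i = d\<close> and then semi-decide \<open>(i, j) \<in> R\<close>.
\<close>

definition recf_pred :: recf where
  "recf_pred = Prec Zero (Proj 0)"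

definition recf_add :: recf where
  "recf_add = Prec (Proj 0) (Comp Succ [Proj 1])"

text \<open>Recursion is on the first argument, so the arguments of the subtraction are swapped.\<close>

definition recf_minus :: recf where
  "recf_minus = Prec (Proj 0) (Comp recf_pred [Proj 1])"

text \<open>With truncated subtraction this sum is zero exactly when the arguments agree, which
  turns equality into a zero test for \<open>Mu\<close>.\<close>

definition recf_absdiff :: recf where
  "recf_absdiff = Comp recf_add [recf_minus, Comp recf_minus [Proj 1, Proj 0]]"

definition recf_pow2 :: recf where
  "recf_pow2 = Prec (Comp Succ [Zero]) (Comp recf_add [Proj 1, Proj 1])"

text \<open>Under \<open>Mu\<close> the arguments are \<open>n\<close>, \<open>d\<close>,
  \<open>j\<close>, so \<open>Proj 1\<close> is \<open>d\<close>. The dummy \<open>j\<close> makes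
  the arity 2, as composition with \<open>Proj 1\<close> requires.\<close>

definition recf_log2 :: recf where
  "recf_log2 = Mu (Comp recf_absdiff [Comp recf_pow2 [Proj 0], Proj 1])"

lemma recf_eval_pred: "recf_eval recf_pred [a] = Some (a - 1)"
  by (induction a) (simp_all add: recf_pred_def)

lemma recf_eval_add: "recf_eval recf_add [a, b] = Some (a + b)"
  by (induction a) (simp_all add: recf_add_def)

lemma recf_eval_minus: "recf_eval recf_minus [a, b] = Some (b - a)"
  by (induction a) (simp_all add: recf_minus_def recf_eval_pred)

lemma recf_eval_absdiff: "recf_eval recf_absdiff [a, b] = Some ((b - a) + (a - b))"
  by (simp add: recf_absdiff_def recf_eval_add recf_eval_minus)

lemma recf_eval_pow2: "recf_eval recf_pow2 [a] = Some (2 ^ a)"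
  by (induction a) (simp_all add: recf_pow2_def recf_eval_add)

lemma recf_arity_log2: "recf_arity 2 recf_log2"
  by (simp add: recf_log2_def recf_absdiff_def recf_pow2_def recf_minus_def recf_add_def
      recf_pred_def)

lemma recf_eval_log2_eq_Some_iff: "recf_eval recf_log2 [d, j] = Some i \<longleftrightarrow> d = 2 ^ i"
proof -
  have zero_iff: "d - 2 ^ n + (2 ^ n - d) = 0 \<longleftrightarrow> 2 ^ n = d" for n :: nat
    by auto
  have least: "(LEAST n. n = i) = i" for i :: nat
    by (rule Least_equality) simp_all
  \<comment> \<open>The searched function is total, so the definedness clause of \<open>Mu\<close>
    holds trivially.\<close>
  have "recf_eval recf_log2 [d, j] =
      (if \<exists>n. 2 ^ n = d then Some (LEAST n. 2 ^ n = d) else None)"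
    by (simp only: recf_log2_def recf_eval.simps list.map nth_Cons_0 One_nat_def nth_Cons_Suc
        those.simps option.case option.map bind.bind_lunit recf_eval_pow2 recf_eval_absdiff
        option.inject zero_iff option.distinct not_False_eq_True simp_thms)
  then show ?thesis
    by (auto simp: least)
qed

lemma re_pairs_singleton_indices:
  assumes "re_pairs R"
  shows "re_pairs {(set_encode {i}, j) | i j. (i, j) \<in> R}"
proof -
  from assms obtain c where c: "recf_arity 2 c" "R = {(a, b). recf_eval c [a, b] \<noteq> None}"
    by (auto simp: re_pairs_def)
  \<comment> \<open>Composition is strict: \<open>?c\<close> diverges when \<open>d\<close> is not a
    power of two, and otherwise behaves as \<open>c\<close> on the exponent and
    \<open>j\<close>.\<close>
  let ?c = "Comp c [recf_log2, Proj 1]"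
  have "recf_eval ?c [d, j] \<noteq> None \<longleftrightarrow> (\<exists>i. d = 2 ^ i \<and> (i, j) \<in> R)" for d j
  proof (cases "recf_eval recf_log2 [d, j]")
    case None
    then have "\<nexists>i. d = 2 ^ i"
      by (metis recf_eval_log2_eq_Some_iff option.distinct(1))
    with None show ?thesis
      by simp
  next
    case (Some i)
    then have "d = 2 ^ i"
      by (simp add: recf_eval_log2_eq_Some_iff)
    with Some show ?thesis
      by (simp add: c(2))
  qed
  then have "{(set_encode {i}, j) | i j. (i, j) \<in> R} = {(d, j). recf_eval ?c [d, j] \<noteq> None}"
    by (auto simp: set_encode_def)
  moreover have "recf_arity 2 ?c"
    using c(1) recf_arity_log2 by (simp add: numeral_2_eq_2)
  ultimately show ?thesis
    unfolding re_pairs_def by blast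
qed

lemma enumeration_operator_Image:
  assumes "re_pairs R"
  shows "enumeration_operator (\<lambda>M. R `` M)"
proof -
  let ?W = "{(set_encode {i}, j) | i j. (i, j) \<in> R}"
  have "(\<exists>D. finite D \<and> D \<subseteq> M \<and> (set_encode D, j) \<in> ?W) \<longleftrightarrow> j \<in> R `` M" for M j
  proof
    assume "\<exists>D. finite D \<and> D \<subseteq> M \<and> (set_encode D, j) \<in> ?W"
    then obtain D i where D: "finite D" "D \<subseteq> M" "set_encode D = set_encode {i}" "(i, j) \<in> R"
      by blast
    \<comment> \<open>Canonical indices are injective on finite sets.\<close>
    then have "D = {i}"
      by (metis set_encode_eq finite.emptyI finite.insertI)
    with D show "j \<in> R `` M"
      by blast
  next
    assume "j \<in> R `` M"
    then obtain i where "i \<in> M" "(i, j) \<in> R"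
      by blast
    then show "\<exists>D. finite D \<and> D \<subseteq> M \<and> (set_encode D, j) \<in> ?W"
      by (intro exI[of _ "{i}"]) blast
  qed
  then have "\<forall>M. R `` M = {j. \<exists>D. finite D \<and> D \<subseteq> M \<and> (set_encode D, j) \<in> ?W}"
    by simp
  then show ?thesis
    unfolding enumeration_operator_def
    using re_pairs_singleton_indices[OF assms] by blast
qed

theorem theorem2p9:
  fixes X :: "'a topology" and Y :: "'b topology"
    and I J :: "nat set"
    and U :: "nat \<Rightarrow> 'a set" and V :: "nat \<Rightarrow> 'b set"
    and E :: "'a set" and f :: "'a \<Rightarrow> 'b"
  assumes "indexed_base X I U"
    and "indexed_base Y J V"
    and "E \<subseteq> topspace X"
    and "f \<in> E \<rightarrow> topspace Y"
    and "\<exists>R. re_pairs R \<and> approximation_system I U J V E f R"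
  shows "computable_wrt I U J V E f"
proof -
  from assms(5) obtain R where R: "re_pairs R" "approximation_system I U J V E f R"
    by blast
  \<comment> \<open>\<open>R \<subseteq> I \<times> J\<close> puts the witness \<open>i\<close> in
    \<open>I\<close> for one inclusion and \<open>j\<close> in \<open>J\<close> for the
    other.\<close>
  have "nbhd_indices J V (f x) = R `` nbhd_indices I U x" if "x \<in> E" for x
    using R(2) that unfolding approximation_system_def nbhd_indices_def by blast
  then show ?thesis
    unfolding computable_wrt_def using enumeration_operator_Image[OF R(1)] by blast
qed

end
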